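(* Let $z\in\mathbb{C}$ with $0<|z|<1$ and $-\pi<\arg z<\pi$, let $\ln z$ denote the principal logarithm, and set $\varphi=\arg(-\ln z)$. Let $n\in\{1,2,\ldots\}$ and let $a\in\mathbb{C}$, $a\notin\{0,-1,-2,\ldots\}$, satisfy $\Re\big[(a-1)e^{i\varphi}\big]<0$. Then $$\Phi(z,n,a)=\frac{(-1)^{n-1}}{(n-1)!}\left\{P\int_0^{\infty e^{i\varphi}}\frac{t^{n-1}e^{at}}{z e^{t}-1}\,dt+\pi\,\frac{\partial^{n-1}}{\partial a^{n-1}}\Big(z^{-a}\cot(\pi a)\Big)\right\},$$ where $z^{-a}=e^{-a\ln z}$.
   Context: The Lerch transcendent is $\Phi(z,s,a)=\sum_{m=0}^{\infty}\frac{z^m}{(a+m)^s}$ for $|z|<1$, $a\neq 0,-1,-2,\ldots$ (and by analytic continuation elsewhere). The integral is taken along the ray $\{t: \arg t=\varphi\}$ from $0$ to $\infty$; the integrand has a pole on this ray at $t=-\ln z$, and $P$ denotes the Cauchy principal value: $P\int_0^{\infty e^{i\varphi}} = \lim_{\varepsilon\to0^+}\Big(\int_0^{-\ln z-\varepsilon e^{i\varphi}}+\int_{-\ln z+\varepsilon e^{i\varphi}}^{\infty e^{i\varphi}}\Big)$, both integrals along the ray. *)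

theory Defs
  imports "HOL-Complex_Analysis.Complex_Analysis"
begin

text \<open>
  The Lerch transcendent as given by its defining series, so only meaningful for
  \<open>norm z < 1\<close>; its analytic continuation in \<open>z\<close> is not covered. The power uses the
  principal branch, which agrees with the ordinary power for natural \<open>s\<close> because
  \<open>a + m \<noteq> 0\<close>.
\<close>
definition lerch_phi :: "complex \<Rightarrow> complex \<Rightarrow> complex \<Rightarrow> complex" where
  "lerch_phi z s a = (\<Sum>m. z ^ m / (a + of_nat m) powr s)"

text \<open>
  Cauchy principal value, at the point \<open>p\<close>, of the integral of \<open>f\<close> along the ray
  \<open>{r * cis \<phi> | r. r \<ge> 0}\<close>, parametrised by \<open>t = r * cis \<phi>\<close>. It is intended for
  \<open>p = norm p * cis \<phi>\<close> with \<open>p \<noteq> 0\<close>, so that the points \<open>p - \<epsilon> * cis \<phi>\<close> and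
  \<open>p + \<epsilon> * cis \<phi>\<close> have parameters \<open>norm p - \<epsilon>\<close> and \<open>norm p + \<epsilon>\<close>. The
  Henstock-Kurzweil integral over the unbounded part is the improper integral to infinity.
\<close>
definition has_pv_ray_integral ::
    "(complex \<Rightarrow> complex) \<Rightarrow> real \<Rightarrow> complex \<Rightarrow> complex \<Rightarrow> bool" where
  "has_pv_ray_integral f \<phi> p I \<longleftrightarrow>
     (let g = (\<lambda>r::real. f (of_real r * cis \<phi>) * cis \<phi>) in
       (\<forall>\<epsilon>. 0 < \<epsilon> \<and> \<epsilon> < norm p \<longrightarrow>
          g integrable_on {0..norm p - \<epsilon>} \<and> g integrable_on {norm p + \<epsilon>..}) \<and>
       ((\<lambda>\<epsilon>. integral {0..norm p - \<epsilon>} g + integral {norm p + \<epsilon>..} g) \<longlongrightarrow> I) (at_right 0))"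

definition pv_ray_integral :: "(complex \<Rightarrow> complex) \<Rightarrow> real \<Rightarrow> complex \<Rightarrow> complex" where
  "pv_ray_integral f \<phi> p = (THE I. has_pv_ray_integral f \<phi> p I)"

end

theory Submission
  imports Defs "HOL-Real_Asymp.Real_Asymp"
begin

text \<open>
  Write \<open>- Ln z = R c\<close> with \<open>c = cis \<phi>\<close>, so that \<open>z e\<^sup>t = e\<^bsup>(r - R) c\<^esup>\<close> at \<open>t = r c\<close>. For \<open>n = 1\<close>,
  expand \<open>1 / (z e\<^sup>t - 1)\<close> into a geometric series on either side of the pole and integrate
  termwise: the integral over the ray with \<open>(R - \<epsilon>, R + \<epsilon>)\<close> removed equals \<open>\<Phi>(z,1,a)\<close> minus
  \<open>z\<^bsup>-a\<^esup>\<close> times the partial fraction series of \<open>\<pi> cot(\<pi> a)\<close>, damped by factors which tend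
  to \<open>1\<close> as \<open>\<epsilon> \<rightarrow> 0\<close>. The damping costs only \<open>O(\<surd>\<epsilon>)\<close>, locally uniformly in \<open>a\<close>. Everything in
  sight is holomorphic in \<open>a\<close>, so the convergence survives \<open>n - 1\<close> differentiations in \<open>a\<close>, which
  put the factor \<open>t\<^bsup>n-1\<^esup>\<close> under the integral.
\<close>

subsection \<open>Partial fractions and exponential integrals\<close>

text \<open>This is the logarithmic derivative of the reflection formula
  \<open>rGamma b * rGamma (1 - b) = sin (pi * b) / pi\<close>: it turns the cotangent into a
  difference of two digamma values. The pole at \<open>-k\<close> is paired with the one at
  \<open>k + 1\<close>, exactly as the two pieces of the ray will deliver them.\<close>

lemma cot_partial_fractions:
  fixes b :: complex
  assumes "b \<notin> \<int>"
  shows "(\<lambda>k. 1 / (b + of_nat k) + 1 / (b - 1 - of_nat k)) sums (of_real pi * cot (of_real pi * b))"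
proof -
  have b: "b \<notin> \<int>\<^sub>\<le>\<^sub>0" "1 - b \<notin> \<int>\<^sub>\<le>\<^sub>0" "b \<noteq> 0" "1 - b \<noteq> 0"
    using assms Ints_diff[of 1 "1 - b"] nonpos_Ints_subset_Ints by auto
  have s: "sin (of_real pi * b) \<noteq> 0"
    using assms by (auto simp: sin_eq_0)
  have "((\<lambda>b. rGamma b * rGamma (1 - b)) has_field_derivative
          rGamma b * rGamma (1 - b) * (Digamma (1 - b) - Digamma b)) (at b)"
    by (rule derivative_eq_intros refl b)+ (simp add: algebra_simps)
  hence "((\<lambda>b. sin (of_real pi * b) / of_real pi) has_field_derivative
          sin (of_real pi * b) / of_real pi * (Digamma (1 - b) - Digamma b)) (at b)"
    by (simp only: rGamma_reflection_complex)
  moreover have "((\<lambda>b. sin (of_real pi * b) / of_real pi) has_field_derivative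
          cos (of_real pi * b)) (at b)"
    by (rule derivative_eq_intros refl | simp)+
  ultimately have "sin (of_real pi * b) / of_real pi * (Digamma (1 - b) - Digamma b) = cos (of_real pi * b)"
    by (rule DERIV_unique)
  hence dg: "Digamma (1 - b) - Digamma b = of_real pi * cot (of_real pi * b)"
    using s by (simp add: cot_def field_simps)
  \<comment> \<open>In the limit formulas for the two digamma values the divergent terms
    \<open>ln m\<close> cancel, which leaves the paired partial sums.\<close>
  have "(\<lambda>m. (of_real (ln (real m)) - (\<Sum>k<m. inverse (1 - b + of_nat k)))
          - (of_real (ln (real m)) - (\<Sum>k<m. inverse (b + of_nat k))))
        \<longlonglongrightarrow> Digamma (1 - b) - Digamma b"
    by (intro tendsto_diff Digamma_LIMSEQ b)
  also have "(\<lambda>m. (of_real (ln (real m)) - (\<Sum>k<m. inverse (1 - b + of_nat k)))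
          - (of_real (ln (real m)) - (\<Sum>k<m. inverse (b + of_nat k)))) =
        (\<lambda>m. \<Sum>k<m. 1 / (b + of_nat k) + 1 / (b - 1 - of_nat k))"
  proof
    fix m
    have "inverse (b - 1 - of_nat k) = - inverse (1 - b + of_nat k)" for k
      by (metis (no_types, opaque_lifting) diff_diff_eq minus_diff_eq inverse_minus_eq add.commute diff_diff_eq2 diff_add_eq)
    thus "(of_real (ln (real m)) - (\<Sum>k<m. inverse (1 - b + of_nat k)))
          - (of_real (ln (real m)) - (\<Sum>k<m. inverse (b + of_nat k))) =
        (\<Sum>k<m. 1 / (b + of_nat k) + 1 / (b - 1 - of_nat k))"
      by (simp add: divide_inverse sum_subtractf)
  qed
  finally show ?thesis
    by (simp add: sums_def dg)
qed

lemma has_integral_exp_complex: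
  fixes w :: complex
  assumes "w \<noteq> 0" "x \<le> y"
  shows "((\<lambda>r. exp (of_real r * w)) has_integral (exp (of_real y * w) - exp (of_real x * w)) / w) {x..y}"
proof -
  have "((\<lambda>r. exp (of_real r * w)) has_integral exp (of_real y * w) / w - exp (of_real x * w) / w) {x..y}"
    using assms
    by (intro fundamental_theorem_of_calculus)
       (auto intro!: derivative_eq_intros has_vector_derivative_real_field[where f = "\<lambda>r. exp (r * w) / w"])
  thus ?thesis
    by (simp add: diff_divide_distrib)
qed

text \<open>Dominated convergence along the truncations \<open>{x..x + k}\<close>; the majorant is
  the modulus \<open>exp (Re w * r)\<close> of the integrand itself.\<close>

lemma has_integral_exp_complex_to_infinity:
  fixes w :: complex
  assumes "Re w < 0"
  shows "((\<lambda>r. exp (of_real r * w)) has_integral - exp (of_real x * w) / w) {x..}"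
proof (rule has_integral_dominated_convergence)
  have w: "w \<noteq> 0" using assms by auto
  show "((\<lambda>r. if r \<in> {x..x + real k} then exp (of_real r * w) else 0)
          has_integral (exp (of_real (x + real k) * w) - exp (of_real x * w)) / w) {x..}" for k
    by (subst has_integral_restrict) (auto intro!: has_integral_exp_complex w simp del: of_real_add)
  show "(\<lambda>r. exp (- (- Re w) * r)) integrable_on {x..}"
    using assms by (intro integrable_on_exp_minus_to_infinity) auto
  show "\<forall>r\<in>{x..}. norm (if r \<in> {x..x + real k} then exp (of_real r * w) else 0) \<le> exp (- (- Re w) * r)" for k
    by (auto simp: mult.commute)
  show "\<forall>r\<in>{x..}. (\<lambda>k. if r \<in> {x..x + real k} then exp (of_real r * w) else 0) \<longlonglongrightarrow> exp (of_real r * w)"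
  proof
    fix r assume "r \<in> {x..}"
    moreover have "eventually (\<lambda>k. real k \<ge> r - x) sequentially"
      by real_asymp
    ultimately have "eventually (\<lambda>k. (if r \<in> {x..x + real k} then exp (of_real r * w) else 0) = exp (of_real r * w)) sequentially"
      by (auto elim!: eventually_mono)
    thus "(\<lambda>k. if r \<in> {x..x + real k} then exp (of_real r * w) else 0) \<longlonglongrightarrow> exp (of_real r * w)"
      by (rule tendsto_eventually)
  qed
  have "(\<lambda>k. norm (exp (of_real (x + real k) * w))) \<longlonglongrightarrow> 0"
    using assms by (simp, real_asymp)
  hence "(\<lambda>k. exp (of_real (x + real k) * w)) \<longlonglongrightarrow> 0"
    by (simp only: tendsto_norm_zero_iff)
  hence "(\<lambda>k. (exp (of_real (x + real k) * w) - exp (of_real x * w)) / w) \<longlonglongrightarrow> (0 - exp (of_real x * w)) / w"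
    using w by (intro tendsto_intros)
  thus "(\<lambda>k. (exp (of_real (x + real k) * w) - exp (of_real x * w)) / w) \<longlonglongrightarrow> - exp (of_real x * w) / w"
    by simp
qed

section \<open>Differentiation under the integral sign\<close>

text \<open>The error of the difference quotient is a second-order Taylor remainder of
  \<open>exp (h * t)\<close>, at most \<open>norm h\<close> times one fixed integrable function.
  Integrability is assumed for all powers and all \<open>b\<close> in \<open>A\<close> because that
  function is the modulus of another member of the family, with power \<open>n + 2\<close> and a
  shifted parameter.\<close>

lemma has_field_derivative_integral_exp_power:
  fixes u :: "real \<Rightarrow> complex" and c b :: complex
  assumes c: "norm c = 1" and "open A" "b \<in> A" and S: "S \<subseteq> {0..}"
    and int: "\<And>b m. b \<in> A \<Longrightarrow> (\<lambda>r. (of_real r * c) ^ m * exp (b * (of_real r * c)) * u r) absolutely_integrable_on S"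
  shows "((\<lambda>b. integral S (\<lambda>r. (of_real r * c) ^ n * exp (b * (of_real r * c)) * u r)) has_field_derivative
           integral S (\<lambda>r. (of_real r * c) ^ Suc n * exp (b * (of_real r * c)) * u r)) (at b)"
proof -
  obtain d where d: "d > 0" "cball b d \<subseteq> A"
    using assms open_contains_cball by blast
  define f where "f = (\<lambda>m b r. (of_real r * c) ^ m * exp (b * (of_real r * c)) * u r)"
  have f_int: "f m b integrable_on S" if "b \<in> A" for m b
    using int[OF that] unfolding f_def by (rule absolutely_integrable_on_def[THEN iffD1, THEN conjunct1])
  \<comment> \<open>\<open>exp (b' t)\<close> is \<open>exp (b t)\<close> times the growth factor \<open>exp (d r)\<close> of the remainder estimate.\<close>
  define b' where "b' = b + of_real d * cnj c"
  have b': "b' \<in> A"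
    using d c by (auto simp: b'_def dist_norm norm_mult subset_iff)
  have cc: "cnj c * c = 1"
    using c using complex_norm_square[of c] by (simp add: mult.commute)
  define C where "C = integral S (\<lambda>r. norm (f (n + 2) b' r))"
  have C_int: "(\<lambda>r. norm (f (n + 2) b' r)) integrable_on S"
    using int[OF b'] unfolding f_def by (rule absolutely_integrable_on_def[THEN iffD1, THEN conjunct2])
  have key: "norm ((integral S (f n (b + h)) - integral S (f n b)) / h - integral S (f (Suc n) b)) \<le> C * norm h"
    if h: "h \<noteq> 0" "norm h \<le> d" for h
  proof -
    have bh: "b + h \<in> A" "b \<in> A"
      using d h assms by (auto simp: dist_norm subset_iff)
    define D where "D = (\<lambda>r. (f n (b + h) r - f n b r) / h - f (Suc n) b r)"
    have D_int: "(D has_integral (integral S (f n (b + h)) - integral S (f n b)) / h - integral S (f (Suc n) b)) S"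
      unfolding D_def by (intro has_integral_diff has_integral_divide integrable_integral f_int bh)
    have "norm (D r) \<le> norm h * norm (f (n + 2) b' r)" if r: "r \<in> S" for r
    proof -
      have r0: "r \<ge> 0" using r S by auto
      define t where "t = of_real r * c"
      have t: "norm t = r" using r0 c by (simp add: t_def norm_mult)
      have "D r = f n b r / h * (exp (h * t) - 1 - h * t)"
        using h by (simp add: D_def f_def t_def field_simps exp_add)
      also have "norm \<dots> \<le> norm (f n b r) / norm h * (exp (norm (h * t)) * norm (h * t) ^ 2)"
      proof -
        have "norm (exp (h * t) - 1 - h * t) \<le> exp (norm (h * t)) * norm (h * t) ^ 2"
          using Taylor_exp_field[of "h * t" 1] by (simp add: diff_diff_eq power2_eq_square)
        thus ?thesis
          unfolding norm_mult[of "f n b r / h"] norm_divide by (intro mult_left_mono) auto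
      qed
      also have "\<dots> = norm h * (norm (f n b r) * r ^ 2 * exp (norm h * r))"
        using h by (simp add: norm_mult t power2_eq_square)
      also have "\<dots> \<le> norm h * (norm (f n b r) * r ^ 2 * exp (d * r))"
        using h r0 by (intro mult_left_mono) (auto intro!: mult_right_mono)
      also have "norm (f n b r) * r ^ 2 * exp (d * r) = norm (f (n + 2) b' r)"
      proof -
        have "b' * t = b * t + of_real d * of_real r * (cnj c * c)"
          by (simp add: b'_def t_def algebra_simps)
        hence "exp (b' * t) = exp (b * t) * exp (of_real (d * r))"
          by (simp add: cc exp_add)
        hence "f (n + 2) b' r = f n b r * t ^ 2 * exp (of_real (d * r))"
          by (simp add: f_def t_def power_add power2_eq_square mult_ac)
        thus ?thesis
          by (simp add: norm_mult norm_power t)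
      qed
      finally show ?thesis .
    qed
    hence "norm (integral S D) \<le> integral S (\<lambda>r. norm h * norm (f (n + 2) b' r))"
      using D_int by (intro integral_norm_bound_integral integrable_on_mult_right C_int)
        (auto simp: integrable_on_def)
    thus ?thesis
      using integral_unique[OF D_int] by (simp add: C_def mult.commute)
  qed
  have "((\<lambda>h. (integral S (f n (b + h)) - integral S (f n b)) / h) \<longlongrightarrow> integral S (f (Suc n) b)) (at 0)"
  proof (rule LIM_zero_cancel)
    show "((\<lambda>h. (integral S (f n (b + h)) - integral S (f n b)) / h - integral S (f (Suc n) b)) \<longlongrightarrow> 0) (at 0)"
    proof (rule Lim_null_comparison)
      show "eventually (\<lambda>h. norm ((integral S (f n (b + h)) - integral S (f n b)) / h - integral S (f (Suc n) b)) \<le> C * norm h) (at 0)"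
        unfolding eventually_at using d key by (intro exI[of _ d]) auto
      show "((\<lambda>h::complex. C * norm h) \<longlongrightarrow> 0) (at 0)"
        by (auto intro!: tendsto_eq_intros)
    qed
  qed
  thus ?thesis
    by (simp add: DERIV_def f_def)
qed

subsection \<open>The integral away from the pole\<close>

text \<open>A bound \<open>q0 < 1\<close> uniform on \<open>S\<close> makes
  \<open>norm (F r) / (1 - q0)\<close> a majorant of all geometric partial sums, so dominated
  convergence permits termwise integration. Cutting out a neighbourhood of the pole is what supplies
  such a \<open>q0\<close>.\<close>

lemma geometric_kernel_integral_sums:
  fixes F q :: "real \<Rightarrow> complex"
  assumes q: "\<And>r. r \<in> S \<Longrightarrow> norm (q r) \<le> q0" "0 \<le> q0" "q0 < 1"
    and F: "(\<lambda>r. norm (F r)) integrable_on S"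
    and J: "\<And>k. ((\<lambda>r. F r * q r ^ k) has_integral J k) S"
  shows "J sums integral S (\<lambda>r. F r / (1 - q r))"
proof -
  define f where "f = (\<lambda>N r. \<Sum>k<N. F r * q r ^ k)"
  have f_int: "(f N has_integral (\<Sum>k<N. J k)) S" for N
    unfolding f_def by (intro has_integral_sum J) auto
  have "(\<lambda>N. integral S (f N)) \<longlonglongrightarrow> integral S (\<lambda>r. F r / (1 - q r))"
  proof (rule dominated_convergence)
    show "f N integrable_on S" for N
      using f_int by (auto simp: integrable_on_def)
    show "(\<lambda>r. norm (F r) * (1 / (1 - q0))) integrable_on S"
      by (intro integrable_on_mult_left F)
    fix r assume r: "r \<in> S"
    show "norm (f N r) \<le> norm (F r) * (1 / (1 - q0))" for N
    proof -
      have "norm (\<Sum>k<N. q r ^ k) \<le> (\<Sum>k<N. q0 ^ k)"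
        using q(1)[OF r] by (intro sum_norm_le) (auto simp: norm_power intro!: power_mono)
      also have "\<dots> \<le> 1 / (1 - q0)"
        using q sum_le_suminf[OF summable_geometric, of q0 "{..<N}"] suminf_geometric[of q0] by auto
      finally show ?thesis
        unfolding f_def sum_distrib_left[symmetric] norm_mult by (intro mult_left_mono) auto
    qed
    have "(\<lambda>k. F r * q r ^ k) sums (F r * (1 / (1 - q r)))"
      using q(1)[OF r] q(3) by (intro sums_mult geometric_sums) auto
    thus "(\<lambda>N. f N r) \<longlonglongrightarrow> F r / (1 - q r)"
      by (simp add: f_def sums_def)
  qed
  thus ?thesis
    by (simp add: sums_def integral_unique[OF f_int])
qed

text \<open>Before the pole \<open>exp ((r - R) * c)\<close> has modulus below 1 and serves as the
  geometric ratio. In each term the endpoint \<open>r = 0\<close> gives the Lerch summand and the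
  endpoint \<open>r = R - \<epsilon>\<close> gives a damped cotangent summand with its pole at
  \<open>b = -k\<close>.\<close>

lemma inner_ray_integral_sums:
  fixes b c :: complex
  assumes c: "Re c > 0" and b: "b \<notin> \<int>" and e: "0 < \<epsilon>" "\<epsilon> \<le> R"
  shows "(\<lambda>k. exp (- (of_nat k * (of_real R * c))) / (b + of_nat k)
            - exp (b * (of_real R * c)) * (exp (- (b + of_nat k) * (of_real \<epsilon> * c)) / (b + of_nat k)))
         sums integral {0..R - \<epsilon>} (\<lambda>r. exp (b * (of_real r * c)) * (c / (exp (of_real (r - R) * c) - 1)))"
    (is "?J sums _")
proof -
  have c0: "c \<noteq> 0" using c by auto
  define F where "F = (\<lambda>r::real. - c * exp (b * (of_real r * c)))"
  define q where "q = (\<lambda>r::real. exp (of_real (r - R) * c))"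
  have "?J sums integral {0..R - \<epsilon>} (\<lambda>r. F r / (1 - q r))"
  proof (rule geometric_kernel_integral_sums)
    show "norm (q r) \<le> exp (- (\<epsilon> * Re c))" if "r \<in> {0..R - \<epsilon>}" for r
      using that mult_right_mono[of "r - R" "- \<epsilon>" "Re c"] c by (simp add: q_def)
    show "exp (- (\<epsilon> * Re c)) < 1"
      using c e by simp
    show "(\<lambda>r. norm (F r)) integrable_on {0..R - \<epsilon>}"
      unfolding F_def by (intro integrable_continuous_interval continuous_intros)
    fix k :: nat
    define w where "w = (b + of_nat k) * c"
    have bk: "b + of_nat k \<noteq> 0"
      using b by (metis Ints_minus Ints_of_nat add_eq_0_iff2 )
    have w: "w \<noteq> 0" using bk c0 by (simp add: w_def)
    have "((\<lambda>r. - c * exp (- (of_nat k * (of_real R * c))) * exp (of_real r * w)) has_integral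
            - c * exp (- (of_nat k * (of_real R * c))) *
              ((exp (of_real (R - \<epsilon>) * w) - exp (of_real 0 * w)) / w)) {0..R - \<epsilon>}"
      using e by (intro has_integral_mult_right has_integral_exp_complex w) auto
    also have "(\<lambda>r. - c * exp (- (of_nat k * (of_real R * c))) * exp (of_real r * w)) = (\<lambda>r. F r * q r ^ k)"
      by (simp add: F_def q_def w_def fun_eq_iff exp_of_nat_mult[symmetric] mult_exp_exp algebra_simps)
    also have "- c * exp (- (of_nat k * (of_real R * c))) *
              ((exp (of_real (R - \<epsilon>) * w) - exp (of_real 0 * w)) / w) = ?J k"
    proof -
      have "exp (- (of_nat k * (of_real R * c))) * exp (of_real (R - \<epsilon>) * w) =
              exp (b * (of_real R * c)) * exp (- (b + of_nat k) * (of_real \<epsilon> * c))"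
        by (simp add: w_def mult_exp_exp algebra_simps)
      hence "- c * exp (- (of_nat k * (of_real R * c))) * ((exp (of_real (R - \<epsilon>) * w) - exp (of_real 0 * w)) / w) =
        (c / w) * (exp (- (of_nat k * (of_real R * c))) - exp (b * (of_real R * c)) * exp (- (b + of_nat k) * (of_real \<epsilon> * c)))"
        by (simp add: algebra_simps diff_divide_distrib)
      also have "c / w = 1 / (b + of_nat k)"
        using c0 by (simp add: w_def)
      finally show ?thesis
        by (simp add: diff_divide_distrib)
    qed
    finally show "((\<lambda>r. F r * q r ^ k) has_integral ?J k) {0..R - \<epsilon>}" .
  qed auto
  also have "(\<lambda>r. F r / (1 - q r)) = (\<lambda>r. exp (b * (of_real r * c)) * (c / (exp (of_real (r - R) * c) - 1)))"
    unfolding F_def q_def by (rule ext, subst minus_diff_eq[symmetric, of "exp _"]) (simp only: divide_minus_right, simp)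
  finally show ?thesis .
qed

text \<open>Beyond the pole the ratio is inverted: \<open>1 / (exp x - 1)\<close> is the sum of
  \<open>exp (-(k + 1) * x)\<close>. This shifts \<open>b\<close> to \<open>b - 1 - k\<close>, which
  accounts for the poles at the positive integers and for the hypothesis on
  \<open>(b - 1) * c\<close>.\<close>

lemma outer_ray_integral_sums:
  fixes b c :: complex
  assumes c: "Re c > 0" and b: "Re ((b - 1) * c) < 0" and e: "0 < \<epsilon>"
  shows "(\<lambda>k. - exp (b * (of_real R * c)) * (exp ((b - 1 - of_nat k) * (of_real \<epsilon> * c)) / (b - 1 - of_nat k)))
         sums integral {R + \<epsilon>..} (\<lambda>r. exp (b * (of_real r * c)) * (c / (exp (of_real (r - R) * c) - 1)))"
    (is "?J sums _")
proof -
  have c0: "c \<noteq> 0" using c by auto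
  define F where "F = (\<lambda>r::real. c * exp (b * (of_real r * c)) * exp (- (of_real (r - R) * c)))"
  define q where "q = (\<lambda>r::real. exp (- (of_real (r - R) * c)))"
  have "?J sums integral {R + \<epsilon>..} (\<lambda>r. F r / (1 - q r))"
  proof (rule geometric_kernel_integral_sums)
    show "norm (q r) \<le> exp (- (\<epsilon> * Re c))" if "r \<in> {R + \<epsilon>..}" for r
      using that mult_right_mono[of "\<epsilon>" "r - R" "Re c"] c by (simp add: q_def)
    show "exp (- (\<epsilon> * Re c)) < 1"
      using c e by simp
    have "(\<lambda>r. norm c * exp (R * Re c) * exp (- (- Re ((b - 1) * c)) * r)) integrable_on {R + \<epsilon>..}"
      using b by (intro integrable_on_mult_right integrable_on_exp_minus_to_infinity) auto
    also have "(\<lambda>r. norm c * exp (R * Re c) * exp (- (- Re ((b - 1) * c)) * r)) = (\<lambda>r. norm (F r))"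
      by (simp add: F_def norm_mult fun_eq_iff mult_exp_exp algebra_simps)
    finally show "(\<lambda>r. norm (F r)) integrable_on {R + \<epsilon>..}" .
    fix k :: nat
    define w where "w = (b - 1 - of_nat k) * c"
    \<comment> \<open>The hypothesis on \<open>b\<close> settles \<open>k = 0\<close>; every further
      factor of the ratio only adds decay.\<close>
    have w: "Re w < 0"
    proof -
      have "Re w = Re ((b - 1) * c) - real k * Re c"
        by (simp add: w_def algebra_simps)
      moreover have "real k * Re c \<ge> 0" using c by simp
      ultimately show ?thesis using b by linarith
    qed
    have "((\<lambda>r. c * exp ((1 + of_nat k) * (of_real R * c)) * exp (of_real r * w)) has_integral
            c * exp ((1 + of_nat k) * (of_real R * c)) * (- exp (of_real (R + \<epsilon>) * w) / w)) {R + \<epsilon>..}"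
      by (intro has_integral_mult_right has_integral_exp_complex_to_infinity w)
    also have "(\<lambda>r. c * exp ((1 + of_nat k) * (of_real R * c)) * exp (of_real r * w)) = (\<lambda>r. F r * q r ^ k)"
      by (simp add: F_def q_def w_def fun_eq_iff exp_of_nat_mult[symmetric] mult_exp_exp algebra_simps)
    also have "c * exp ((1 + of_nat k) * (of_real R * c)) * (- exp (of_real (R + \<epsilon>) * w) / w) = ?J k"
    proof -
      have "exp ((1 + of_nat k) * (of_real R * c)) * exp (of_real (R + \<epsilon>) * w) =
              exp (b * (of_real R * c)) * exp ((b - 1 - of_nat k) * (of_real \<epsilon> * c))"
        by (simp add: w_def mult_exp_exp algebra_simps)
      hence "c * exp ((1 + of_nat k) * (of_real R * c)) * (- exp (of_real (R + \<epsilon>) * w) / w) =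
        - (c / w) * (exp (b * (of_real R * c)) * exp ((b - 1 - of_nat k) * (of_real \<epsilon> * c)))"
        by (simp add: algebra_simps)
      also have "c / w = 1 / (b - 1 - of_nat k)"
        using c0 by (simp add: w_def)
      finally show ?thesis
        by simp
    qed
    finally show "((\<lambda>r. F r * q r ^ k) has_integral ?J k) {R + \<epsilon>..}" .
  qed auto
  also have "(\<lambda>r. F r / (1 - q r)) = (\<lambda>r. exp (b * (of_real r * c)) * (c / (exp (of_real (r - R) * c) - 1)))"
  proof
    fix r
    have "1 - q r = exp (- (of_real (r - R) * c)) * (exp (of_real (r - R) * c) - 1)"
      by (simp add: q_def right_diff_distrib mult_exp_exp)
    thus "F r / (1 - q r) = exp (b * (of_real r * c)) * (c / (exp (of_real (r - R) * c) - 1))"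
      by (simp add: F_def)
  qed
  finally show ?thesis .
qed

section \<open>Absolute integrability on the two pieces of the ray\<close>

lemma power_times_exp_bound:
  fixes r \<beta> :: real
  assumes "r \<ge> 0" "\<beta> > 0"
  shows "r ^ m \<le> fact m / \<beta> ^ m * exp (\<beta> * r)"
proof -
  have "(\<beta> * r) ^ m / fact m \<le> exp (\<beta> * r)"
    using assms sum_le_suminf[OF summable_exp_generic[of "\<beta> * r"], of "{m}"]
    by (simp add: exp_def field_simps)
  thus ?thesis
    using assms by (simp add: field_simps power_mult_distrib)
qed

text \<open>Zeros of \<open>exp w - 1\<close> lie on the imaginary axis, which the line through
  \<open>c\<close> meets only at the origin. Hence the kernel has just one pole on the ray.\<close>

lemma exp_ray_minus_1_nonzero:
  fixes c :: complex
  assumes "Re c > 0" "r \<noteq> (0::real)"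
  shows "exp (of_real r * c) - 1 \<noteq> 0"
proof
  assume "exp (of_real r * c) - 1 = 0"
  hence "norm (exp (of_real r * c)) = 1" by simp
  thus False using assms by simp
qed

lemma inner_ray_absolutely_integrable:
  fixes b c :: complex
  assumes c: "Re c > 0" and e: "0 < \<epsilon>"
  shows "(\<lambda>r. (of_real r * c) ^ m * exp (b * (of_real r * c)) * (c / (exp (of_real (r - R) * c) - 1)))
           absolutely_integrable_on {0..R - \<epsilon>}"
  by (intro absolutely_integrable_continuous_real continuous_intros ballI exp_ray_minus_1_nonzero c)
     (use e in auto)

lemma outer_ray_absolutely_integrable:
  fixes b c :: complex
  assumes c: "Re c > 0" and b: "Re ((b - 1) * c) < 0" and e: "0 < \<epsilon>" "0 \<le> R"
  shows "(\<lambda>r. (of_real r * c) ^ m * exp (b * (of_real r * c)) * (c / (exp (of_real (r - R) * c) - 1)))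
           absolutely_integrable_on {R + \<epsilon>..}" (is "?f absolutely_integrable_on _")
proof (rule measurable_bounded_by_integrable_imp_absolutely_integrable)
  show "?f \<in> borel_measurable (lebesgue_on {R + \<epsilon>..})"
    by (intro continuous_imp_measurable_on_sets_lebesgue continuous_intros ballI exp_ray_minus_1_nonzero c)
       (use e in auto)
  \<comment> \<open>Half of the available decay rate \<open>2 * \<beta>\<close>: one half absorbs
    the power \<open>r ^ m\<close>, the other keeps the majorant integrable.\<close>
  define \<beta> where "\<beta> = - Re ((b - 1) * c) / 2"
  have \<beta>: "\<beta> > 0" using b by (simp add: \<beta>_def)
  define q0 where "q0 = exp (- (\<epsilon> * Re c))"
  have q0: "q0 < 1" using c e by (simp add: q0_def)
  define K where "K = fact m / \<beta> ^ m * norm c ^ Suc m * exp (R * Re c) / (1 - q0)"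
  show "(\<lambda>r. K * exp (- \<beta> * r)) integrable_on {R + \<epsilon>..}"
    using \<beta> by (intro integrable_on_mult_right integrable_on_exp_minus_to_infinity)
  fix r assume r: "r \<in> {R + \<epsilon>..}"
  define s where "s = of_real (r - R) * c"
  have s: "exp (- Re s) \<le> q0"
    using r mult_right_mono[of "\<epsilon>" "r - R" "Re c"] c by (simp add: s_def q0_def)
  \<comment> \<open>The denominator grows like \<open>exp (Re s)\<close> away from the pole, so the
    kernel contributes the decay that replaces \<open>b\<close> by \<open>b - 1\<close> in the
    exponent.\<close>
  have "exp (Re s) * (1 - q0) \<le> exp (Re s) * (1 - exp (- Re s))"
    using s by (intro mult_left_mono) auto
  also have "\<dots> = norm (exp s) - norm (1 :: complex)"
    by (simp add: right_diff_distrib mult_exp_exp)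
  also have "\<dots> \<le> norm (exp s - 1)"
    by (rule norm_triangle_ineq2)
  finally have *: "exp (Re s) * (1 - q0) \<le> norm (exp s - 1)" .
  have pos: "0 < exp (Re s) * (1 - q0)"
    using q0 by simp
  have "norm (c / (exp s - 1)) \<le> norm c / (exp (Re s) * (1 - q0))"
    unfolding norm_divide
    by (rule divide_left_mono[OF * norm_ge_zero mult_pos_pos[OF less_le_trans[OF pos *] pos]])
  hence "norm (?f r) \<le> norm ((of_real r * c) ^ m * exp (b * (of_real r * c))) * (norm c / (exp (Re s) * (1 - q0)))"
    unfolding s_def norm_mult[of "_ * exp _"] by (rule mult_left_mono) simp
  also have "norm ((of_real r * c) ^ m * exp (b * (of_real r * c))) = (r ^ m * norm c ^ m) * exp (Re (b * c) * r)"
    using r e by (simp add: norm_mult norm_power power_mult_distrib algebra_simps)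
  also have "(r ^ m * norm c ^ m) * exp (Re (b * c) * r) * (norm c / (exp (Re s) * (1 - q0)))
      = r ^ m * (exp (R * Re c) * norm c ^ Suc m / (1 - q0) * exp (- (2 * \<beta>) * r))"
  proof -
    have "exp (Re (b * c) * r) = exp (Re s) * (exp (R * Re c) * exp (- (2 * \<beta>) * r))"
      unfolding mult_exp_exp by (simp add: \<beta>_def s_def field_simps)
    thus ?thesis by simp
  qed
  also have "\<dots> \<le> fact m / \<beta> ^ m * exp (\<beta> * r) * (exp (R * Re c) * norm c ^ Suc m / (1 - q0) * exp (- (2 * \<beta>) * r))"
    using r e \<beta> q0 by (intro mult_right_mono power_times_exp_bound) auto
  also have "\<dots> = K * (exp (\<beta> * r) * exp (- (2 * \<beta>) * r))"
    by (simp add: K_def)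
  also have "exp (\<beta> * r) * exp (- (2 * \<beta>) * r) = exp (- \<beta> * r)"
    unfolding mult_exp_exp by simp
  finally show "norm (?f r) \<le> K * exp (- \<beta> * r)" .
qed auto

subsection \<open>The damped cotangent series\<close>

text \<open>Weaker than a linear bound near 0, but valid on the whole left half-plane, where
  \<open>k * \<epsilon>\<close> may be large. The exponent 1/2 lets the sum over \<open>k\<close>
  converge and still leaves a positive power of \<epsilon>. The constant 3 comes from
  \<open>exp 1 \<le> 3\<close> for small \<open>w\<close> and from \<open>1 + 1\<close>
  otherwise.\<close>

lemma norm_exp_minus_1_le_sqrt:
  fixes w :: complex
  assumes "Re w \<le> 0"
  shows "norm (exp w - 1) \<le> 3 * sqrt (norm w)"
proof (cases "norm w \<le> 1")
  case True
  have "norm (exp w - 1) \<le> exp (norm w) * norm w"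
    using Taylor_exp_field[of w 0] by simp
  also have "\<dots> \<le> 3 * norm w"
    using True exp_le order_trans[of "exp (norm w)" "exp 1" 3] by (intro mult_right_mono) auto
  also have "norm w \<le> sqrt (norm w)"
    using True by (intro real_le_rsqrt) (auto simp: power2_eq_square mult_left_le)
  finally show ?thesis by simp
next
  case False
  have "norm (exp w - 1) \<le> norm (exp w) + 1"
    using norm_triangle_ineq4[of "exp w" 1] by simp
  also have "\<dots> \<le> 3 * 1"
    using assms order_trans[of "exp (Re w)" 1 2] by simp
  also have "\<dots> \<le> 3 * sqrt (norm w)"
    using False by (intro mult_left_mono) auto
  finally show ?thesis .
qed

lemma exp_minus_le_inverse_sqrt:
  fixes y :: real
  assumes "y > 0"
  shows "exp (- y) \<le> 1 / sqrt y"
proof -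
  have "sqrt y \<le> 1 + y"
    using assms by (intro real_le_lsqrt) (auto simp: power2_eq_square algebra_simps)
  also have "\<dots> \<le> exp y" by (rule exp_ge_add_one_self)
  finally show ?thesis
    using assms by (simp add: exp_minus field_simps)
qed

text \<open>
  Splitting off \<open>E = e\<^bsup>-k\<epsilon>c\<^esup>\<close> leaves two terms \<open>E (e\<^bsup>v\<epsilon>c\<^esup> - 1) / q\<close>, of size \<open>\<epsilon> / k\<close> times
  \<open>|E| \<le> const / \<surd>(k\<epsilon>)\<close>, and the term \<open>(E - 1)\<close> times the paired fractions, which are \<open>O(1 / k\<^sup>2)\<close>.
\<close>
lemma damped_cot_term_bound:
  fixes b c :: complex and k :: nat
  assumes c: "norm c = 1" "Re c > 0" and e: "0 < \<epsilon>" "\<epsilon> \<le> 1"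
    and B: "norm b \<le> B" "norm (b - 1) \<le> B"
    and M: "norm (1 / (b + of_nat k)) \<le> M / (real k + 1)" "norm (1 / (b - 1 - of_nat k)) \<le> M / (real k + 1)"
    and nz: "b + of_nat k \<noteq> 0" "b - 1 - of_nat k \<noteq> 0"
  shows "norm (exp (- (b + of_nat k) * (of_real \<epsilon> * c)) / (b + of_nat k)
              + exp ((b - 1 - of_nat k) * (of_real \<epsilon> * c)) / (b - 1 - of_nat k)
              - (1 / (b + of_nat k) + 1 / (b - 1 - of_nat k)))
         \<le> (2 * exp 1 * B * exp B * M / sqrt (Re c) + 6 * B * M ^ 2) * sqrt \<epsilon> * (1 / ((real k + 1) * sqrt (real k + 1)))"
proof -
  define \<delta> where "\<delta> = of_real \<epsilon> * c"
  define p where "p = b + of_nat k"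
  define p' where "p' = b - 1 - of_nat k"
  define E where "E = exp (- (of_nat k * \<delta>))"
  define x where "x = real k + 1"
  have x: "x > 0" by (simp add: x_def)
  have \<delta>: "norm \<delta> = \<epsilon>" "Re \<delta> = \<epsilon> * Re c" using c e by (auto simp: \<delta>_def norm_mult)
  have M0: "M \<ge> 0" using order_trans[OF norm_ge_zero M(1)] x by (simp add: x_def zero_le_divide_iff)
  have B0: "B \<ge> 0" using order_trans[OF norm_ge_zero B(1)] .
  have c1: "Re c \<le> 1" using complex_Re_le_cmod[of c] c by simp
  have E: "norm E \<le> exp 1 / (sqrt x * sqrt (Re c) * sqrt \<epsilon>)"
  proof -
    \<comment> \<open>Replacing \<open>k\<close> by \<open>x = k + 1\<close> avoids division by zero
      at \<open>k = 0\<close>; it costs the factor \<open>exp (\<epsilon> * Re c)\<close>, at most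
      \<open>exp 1\<close>.\<close>
    have "norm E = exp (\<epsilon> * Re c) * exp (- (x * Re c * \<epsilon>))"
      by (simp add: E_def \<delta> x_def mult_exp_exp algebra_simps)
    also have "\<dots> \<le> exp 1 * (1 / sqrt (x * Re c * \<epsilon>))"
      using c e x c1 mult_mono[of \<epsilon> 1 "Re c" 1] by (intro mult_mono exp_minus_le_inverse_sqrt) auto
    finally show ?thesis by (simp add: real_sqrt_mult)
  qed
  have main: "norm (E * (exp (v * \<delta>) - 1) * (1 / q)) \<le> exp 1 * B * exp B * M / sqrt (Re c) * sqrt \<epsilon> * (1 / (x * sqrt x))"
    if v: "norm v \<le> B" and q: "norm (1 / q) \<le> M / x" for v q
  proof -
    have "norm (exp (v * \<delta>) - 1) \<le> exp (norm (v * \<delta>)) * norm (v * \<delta>)"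
      using Taylor_exp_field[of "v * \<delta>" 0] by simp
    also have "\<dots> = exp (norm v * \<epsilon>) * (norm v * \<epsilon>)"
      by (simp add: norm_mult \<delta>)
    also have "\<dots> \<le> exp B * (B * \<epsilon>)"
      using v e B0 mult_mono[of "norm v" B \<epsilon> 1] by (intro mult_mono) auto
    finally have "norm (E * (exp (v * \<delta>) - 1) * (1 / q)) \<le>
        exp 1 / (sqrt x * sqrt (Re c) * sqrt \<epsilon>) * (exp B * (B * \<epsilon>)) * (M / x)"
      unfolding norm_mult using q E e c x B0 by (intro mult_mono) auto
    also have "\<dots> = exp 1 * B * exp B * M / sqrt (Re c) * (\<epsilon> / sqrt \<epsilon>) * (1 / (x * sqrt x))"
      by (simp add: mult_ac)
    also have "\<epsilon> / sqrt \<epsilon> = sqrt \<epsilon>"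
      using e by (simp add: real_div_sqrt)
    finally show ?thesis .
  qed
  have "norm (E - 1) \<le> 3 * sqrt (norm (- (of_nat k * \<delta>)))"
    unfolding E_def using c e by (intro norm_exp_minus_1_le_sqrt) (simp add: \<delta>)
  also have "\<dots> = 3 * (sqrt (real k) * sqrt \<epsilon>)"
    by (simp add: norm_mult \<delta> real_sqrt_mult)
  also have "\<dots> \<le> 3 * (sqrt x * sqrt \<epsilon>)"
    using e by (intro mult_left_mono mult_right_mono) (auto simp: x_def)
  finally have E1: "norm (E - 1) \<le> 3 * (sqrt x * sqrt \<epsilon>)" .
  \<comment> \<open>In the numerator \<open>p + p'\<close> the index \<open>k\<close> cancels, so
    the paired fractions are of order \<open>1 / x^2\<close>.\<close>
  have "1 / p + 1 / p' = (b + (b - 1)) * (1 / p) * (1 / p')"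
    using nz by (simp add: p_def p'_def field_simps)
  also have "norm \<dots> \<le> (B + B) * (M / x) * (M / x)"
    unfolding norm_mult using M M0 B0 x B
    by (intro mult_mono order_trans[OF norm_triangle_ineq] add_mono) (auto simp: p_def p'_def x_def)
  finally have pp: "norm (1 / p + 1 / p') \<le> (B + B) * (M / x) * (M / x)" .
  have "norm ((E - 1) * (1 / p + 1 / p')) \<le> 3 * (sqrt x * sqrt \<epsilon>) * ((B + B) * (M / x) * (M / x))"
    unfolding norm_mult using E1 pp x e by (intro mult_mono) auto
  also have "\<dots> = 6 * B * M ^ 2 * sqrt \<epsilon> * (sqrt x / x ^ 2)"
    by (simp add: power2_eq_square)
  also have "sqrt x / x ^ 2 = 1 / (x * sqrt x)"
    using x by (simp add: field_simps power2_eq_square)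
  finally have third: "norm ((E - 1) * (1 / p + 1 / p')) \<le> 6 * B * M ^ 2 * sqrt \<epsilon> * (1 / (x * sqrt x))" .
  have "exp (- p * \<delta>) = E * exp ((- b) * \<delta>)" "exp (p' * \<delta>) = E * exp ((b - 1) * \<delta>)"
    by (simp_all add: E_def p_def p'_def mult_exp_exp algebra_simps)
  hence "exp (- p * \<delta>) / p + exp (p' * \<delta>) / p' - (1 / p + 1 / p') =
     E * (exp ((- b) * \<delta>) - 1) * (1 / p) + E * (exp ((b - 1) * \<delta>) - 1) * (1 / p') + (E - 1) * (1 / p + 1 / p')"
    by (simp add: algebra_simps diff_divide_distrib)
  also have "norm \<dots> \<le> exp 1 * B * exp B * M / sqrt (Re c) * sqrt \<epsilon> * (1 / (x * sqrt x))
      + exp 1 * B * exp B * M / sqrt (Re c) * sqrt \<epsilon> * (1 / (x * sqrt x))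
      + 6 * B * M ^ 2 * sqrt \<epsilon> * (1 / (x * sqrt x))"
    using B M third by (intro order_trans[OF norm_triangle_ineq] add_mono main) (auto simp: p_def p'_def x_def)
  also have "\<dots> = (2 * exp 1 * B * exp B * M / sqrt (Re c) + 6 * B * M ^ 2) * sqrt \<epsilon> * (1 / (x * sqrt x))"
    by (simp add: algebra_simps add_divide_distrib)
  finally show ?thesis
    by (simp add: p_def p'_def x_def \<delta>_def)
qed

lemma summable_inverse_three_halves: "summable (\<lambda>k. 1 / ((real k + 1) * sqrt (real k + 1)))"
proof -
  have "real (Suc k) powr (- (3 / 2)) = 1 / ((real k + 1) * sqrt (real k + 1))" for k
  proof -
    have "real (Suc k) powr (1 + 1 / 2) = real (Suc k) powr 1 * real (Suc k) powr (1 / 2)"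
      by (rule powr_add)
    also have "\<dots> = (real k + 1) * sqrt (real k + 1)"
      by (subst powr_half_sqrt) (auto simp: add.commute)
    finally have "real (Suc k) powr (3 / 2) = (real k + 1) * sqrt (real k + 1)"
      by simp
    thus ?thesis
      by (simp only: powr_minus divide_inverse mult_1_left)
  qed
  moreover have "summable (\<lambda>k. real (Suc k) powr (- (3 / 2)))"
    unfolding summable_Suc_iff[of "\<lambda>k. real k powr (- (3 / 2))"] summable_real_powr_iff by simp
  ultimately show ?thesis
    by (simp only:)
qed

text \<open>Makes the termwise bound uniform on a ball that avoids the integers, and sums it against
  \<open>(k + 1)\<close> to the power -3/2. Convergence of the damped series is a premise, since it
  will come from the integrals. The distance bound is exported for the Lerch series.\<close>

lemma damped_cot_series_bound:
  fixes a c :: complex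
  assumes a: "a \<notin> \<int>" and c: "norm c = 1" "Re c > 0"
  obtains d C where "d > 0" and "\<And>b m. b \<in> ball a d \<Longrightarrow> norm (b + of_int m) \<ge> d"
    and "\<And>b \<epsilon> s. b \<in> ball a d \<Longrightarrow> 0 < \<epsilon> \<Longrightarrow> \<epsilon> \<le> 1 \<Longrightarrow>
      (\<lambda>k. exp (- (b + of_nat k) * (of_real \<epsilon> * c)) / (b + of_nat k)
         + exp ((b - 1 - of_nat k) * (of_real \<epsilon> * c)) / (b - 1 - of_nat k)) sums s \<Longrightarrow>
      norm (s - of_real pi * cot (of_real pi * b)) \<le> C * sqrt \<epsilon>"
proof -
  have "open (- (\<int> :: complex set))"
    using closed_Ints by (rule open_Compl)
  then obtain e where e: "e > 0" "ball a e \<subseteq> - \<int>"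
    using a open_contains_ball by (metis ComplI)
  \<comment> \<open>Halving keeps every point of \<open>ball a d\<close> at distance at least
    \<open>d\<close> from every integer.\<close>
  define d where "d = e / 2"
  define B where "B = norm a + d + 1"
  \<comment> \<open>The summand 2 serves large \<open>k\<close>, where
    \<open>k - B \<ge> (k + 1) / 2\<close>; the other summand serves \<open>k < 2 * B + 1\<close>,
    where only the distance \<open>d\<close> is available and
    \<open>d * M \<ge> k + 1\<close>.\<close>
  define M where "M = 2 + (2 * B + 2) / d"
  have d: "d > 0" using e by (simp add: d_def)
  have B0: "B > 0" using d by (simp add: B_def add_nonneg_pos)
  have far: "norm (b + of_int m) \<ge> d" if "b \<in> ball a d" for b m
  proof (rule ccontr)
    assume "\<not> norm (b + of_int m) \<ge> d"
    moreover have "dist a (- of_int m) \<le> dist a b + norm (b + of_int m)"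
      using norm_triangle_ineq[of "a - b" "b + of_int m"] by (simp add: dist_norm)
    ultimately have "- of_int m \<in> ball a e"
      using that by (simp add: d_def)
    thus False using e Ints_of_int[of "- m"] by auto
  qed
  have notint: "b \<notin> \<int>" if "b \<in> ball a d" for b
    using that e d subset_ball[of d e a] by (auto simp: d_def)
  have M: "M > 0"
    unfolding M_def using B0 d by (intro add_pos_pos divide_pos_pos) auto
  have inv: "norm (1 / q) \<le> M / (real k + 1)" if q: "norm q \<ge> d" "norm q \<ge> real k - B" for q :: complex and k :: nat
  proof -
    have "(real k + 1) / M \<le> norm q"
    proof (cases "real k \<ge> 2 * B + 1")
      case True
      have "(real k + 1) / M \<le> (real k + 1) / 2"
        using B0 d M by (intro divide_left_mono mult_pos_pos) (auto simp: M_def)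
      also have "\<dots> \<le> real k - B" using True by simp
      finally show ?thesis using q by linarith
    next
      case False
      have "d * M = 2 * d + (2 * B + 2)" using d by (simp add: M_def field_simps)
      hence "real k + 1 \<le> d * M" using False d by linarith
      hence "(real k + 1) / M \<le> d" using M by (simp add: field_simps)
      thus ?thesis using q by simp
    qed
    moreover have "norm q > 0" using q d by linarith
    ultimately show ?thesis using M by (simp add: norm_divide field_simps)
  qed
  define C where "C = 2 * exp 1 * B * exp B * M / sqrt (Re c) + 6 * B * M ^ 2"
  define Z where "Z = (\<Sum>k. 1 / ((real k + 1) * sqrt (real k + 1)))"
  have "norm (s - of_real pi * cot (of_real pi * b)) \<le> C * Z * sqrt \<epsilon>"
    if b: "b \<in> ball a d" and eps: "0 < \<epsilon>" "\<epsilon> \<le> 1" and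
      s: "(\<lambda>k. exp (- (b + of_nat k) * (of_real \<epsilon> * c)) / (b + of_nat k)
         + exp ((b - 1 - of_nat k) * (of_real \<epsilon> * c)) / (b - 1 - of_nat k)) sums s" for b \<epsilon> s
  proof -
    define T where "T = (\<lambda>k. exp (- (b + of_nat k) * (of_real \<epsilon> * c)) / (b + of_nat k)
         + exp ((b - 1 - of_nat k) * (of_real \<epsilon> * c)) / (b - 1 - of_nat k)
         - (1 / (b + of_nat k) + 1 / (b - 1 - of_nat k)))"
    have nb: "norm b \<le> norm a + d"
      using b norm_triangle_ineq2[of b a] by (auto simp: dist_norm norm_minus_commute)
    have T: "T sums (s - of_real pi * cot (of_real pi * b))"
      unfolding T_def by (intro sums_diff s cot_partial_fractions notint b)
    have bound: "norm (T k) \<le> C * sqrt \<epsilon> * (1 / ((real k + 1) * sqrt (real k + 1)))" for k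
      unfolding T_def C_def
    proof (rule damped_cot_term_bound)
      show B1: "norm b \<le> B" "norm (b - 1) \<le> B"
        using nb norm_triangle_ineq4[of b 1] by (auto simp: B_def)
      have f: "norm (b + of_nat k) \<ge> d" "norm (b - 1 - of_nat k) \<ge> d"
        using far[OF b, of "int k"] far[OF b, of "- 1 - int k"] by (simp_all add: algebra_simps)
      have g: "norm (b + of_nat k) \<ge> real k - B" "norm (b - 1 - of_nat k) \<ge> real k - B"
        using B1 norm_triangle_ineq2[of "of_nat k" "- b"] norm_triangle_ineq2[of "of_nat k" "b - 1"]
        by (auto simp: add.commute norm_minus_commute)
      show "norm (1 / (b + of_nat k)) \<le> M / (real k + 1)" "norm (1 / (b - 1 - of_nat k)) \<le> M / (real k + 1)"
        by (rule inv f g)+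
      show "b + of_nat k \<noteq> 0" "b - 1 - of_nat k \<noteq> 0"
        using f d by auto
    qed (use c eps in auto)
    have sm: "summable (\<lambda>k. C * sqrt \<epsilon> * (1 / ((real k + 1) * sqrt (real k + 1))))"
      by (intro summable_mult summable_inverse_three_halves)
    have "norm (\<Sum>k. T k) \<le> (\<Sum>k. C * sqrt \<epsilon> * (1 / ((real k + 1) * sqrt (real k + 1))))"
      by (rule norm_suminf_le[OF bound sm])
    also have "\<dots> = C * sqrt \<epsilon> * Z"
      unfolding Z_def by (rule suminf_mult[OF summable_inverse_three_halves])
    finally show ?thesis
      using sums_unique[OF T] by (simp add: mult_ac)
  qed
  with d far show ?thesis by (rule that)
qed

subsection \<open>Passage to the limit\<close>

text \<open>Reads iterated derivatives off an explicit tower. Agreement on the open set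
  \<open>A\<close> holds near each of its points, so it survives another
  \<open>deriv\<close>.\<close>

lemma higher_deriv_eqI:
  fixes F :: "nat \<Rightarrow> complex \<Rightarrow> complex"
  assumes "open A" and F: "\<And>m b. b \<in> A \<Longrightarrow> (F m has_field_derivative F (Suc m) b) (at b)"
    and "b \<in> A"
  shows "(deriv ^^ m) (F 0) b = F m b"
  using \<open>b \<in> A\<close>
proof (induction m arbitrary: b)
  case (Suc m)
  have "eventually (\<lambda>x. x \<in> A) (nhds b)"
    using assms Suc.prems by (intro eventually_nhds_in_open)
  hence "eventually (\<lambda>x. (deriv ^^ m) (F 0) x = F m x) (nhds b)"
    by eventually_elim (rule Suc.IH)
  hence "deriv ((deriv ^^ m) (F 0)) b = deriv (F m) b"
    by (intro deriv_cong_ev) auto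
  also have "\<dots> = F (Suc m) b"
    using F[OF Suc.prems] by (rule DERIV_imp_deriv)
  finally show ?case by simp
qed simp

text \<open>Differentiating \<open>1 / (b + k)\<close> repeatedly raises the order of the pole, so
  the series of order 1 generates all integer orders. The majorant \<open>norm z ^ k / d\<close>
  gives uniform convergence on the ball, under which derivatives of holomorphic partial sums
  converge too.\<close>

lemma lerch_series_higher_deriv:
  fixes z a :: complex
  assumes z: "norm z < 1" and d: "d > 0" "\<And>b m. b \<in> ball a d \<Longrightarrow> norm (b + of_int m) \<ge> d"
  shows "(deriv ^^ m) (\<lambda>b. \<Sum>k. z ^ k / (b + of_nat k)) a = (-1) ^ m * fact m * lerch_phi z (of_nat (Suc m)) a"
    and "b \<in> ball a d \<Longrightarrow> summable (\<lambda>k. z ^ k / (b + of_nat k))"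
proof -
  have far: "norm (b + of_nat k) \<ge> d" "b + of_nat k \<noteq> 0" if "b \<in> ball a d" for b and k :: nat
    using d(2)[OF that, of "int k"] d(1) by auto
  define F where "F = (\<lambda>N m b. \<Sum>k<N. (-1) ^ m * fact m * (z ^ k / (b + of_nat k) ^ Suc m))"
  have bound: "norm (z ^ k / (b + of_nat k)) \<le> norm z ^ k / d" if "b \<in> ball a d" for b k
    using far[OF that] d(1) unfolding norm_divide norm_power
    by (intro divide_left_mono mult_pos_pos) auto
  have sm: "summable (\<lambda>k. norm z ^ k / d)"
    using z by (intro summable_divide summable_geometric) simp
  show "summable (\<lambda>k. z ^ k / (b + of_nat k))" if "b \<in> ball a d" for b
    by (rule summable_comparison_test'[OF sm bound[OF that]])
  have deriv_F: "(F N m has_field_derivative F N (Suc m) b) (at b)" if "b \<in> ball a d" for N m b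
  proof -
    have *: "((\<lambda>b. (-1) ^ m * fact m * (z ^ k / (b + of_nat k) ^ Suc m)) has_field_derivative
            (-1) ^ Suc m * fact (Suc m) * (z ^ k / (b + of_nat k) ^ Suc (Suc m))) (at b)" for k
    proof -
      define y where "y = b + of_nat k"
      have y: "y \<noteq> 0" using far(2)[OF that, of k] by (simp add: y_def)
      have "((\<lambda>b. (-1) ^ m * fact m * (z ^ k * inverse ((b + of_nat k) ^ Suc m))) has_field_derivative
            (-1) ^ m * fact m * (z ^ k * (- (inverse (y ^ Suc m) * (of_nat (Suc m) * y ^ m) * inverse (y ^ Suc m))))) (at b)"
        unfolding y_def using far(2)[OF that, of k]
        by (auto intro!: derivative_eq_intros simp del: power_Suc of_nat_Suc)
      moreover have "inverse (y ^ Suc m) * (of_nat (Suc m) * y ^ m) * inverse (y ^ Suc m) = of_nat (Suc m) / y ^ Suc (Suc m)"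
        using y by (simp add: divide_simps del: of_nat_Suc)
      ultimately show ?thesis
        by (simp add: divide_inverse y_def mult_ac del: power_Suc of_nat_Suc) (simp add: mult_ac)
    qed
    show ?thesis
      unfolding F_def by (intro derivative_intros *)
  qed
  have holo_F: "F N 0 holomorphic_on ball a d" for N
    unfolding holomorphic_on_open[OF open_ball] using deriv_F by blast
  have "uniform_limit (ball a d) (\<lambda>N b. \<Sum>k<N. z ^ k / (b + of_nat k)) (\<lambda>b. \<Sum>k. z ^ k / (b + of_nat k)) sequentially"
    by (rule Weierstrass_m_test[OF bound sm])
  also have "(\<lambda>N b. \<Sum>k<N. z ^ k / (b + of_nat k)) = (\<lambda>N. F N 0)"
    by (simp add: F_def)
  finally have "(\<lambda>N. (deriv ^^ m) (F N 0) a) \<longlonglongrightarrow> (deriv ^^ m) (\<lambda>b. \<Sum>k. z ^ k / (b + of_nat k)) a"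
    using d(1) holo_F
    by (intro higher_deriv_complex_uniform_limit[where A = "ball a d"] always_eventually) auto
  also have "(\<lambda>N. (deriv ^^ m) (F N 0) a) = (\<lambda>N. F N m a)"
    using d(1) by (intro ext higher_deriv_eqI[where A = "ball a d"] deriv_F) auto
  finally have "(\<lambda>k. (-1) ^ m * fact m * (z ^ k / (a + of_nat k) ^ Suc m)) sums (deriv ^^ m) (\<lambda>b. \<Sum>k. z ^ k / (b + of_nat k)) a"
    by (simp add: F_def sums_def)
  hence "(\<lambda>k. (-1) ^ m / fact m * ((-1) ^ m * fact m * (z ^ k / (a + of_nat k) ^ Suc m))) sums
           ((-1) ^ m / fact m * (deriv ^^ m) (\<lambda>b. \<Sum>k. z ^ k / (b + of_nat k)) a)"
    by (rule sums_mult)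
  also have "(\<lambda>k. (-1) ^ m / fact m * ((-1) ^ m * fact m * (z ^ k / (a + of_nat k) ^ Suc m))) =
      (\<lambda>k. z ^ k / (a + of_nat k) powr of_nat (Suc m))"
  proof
    fix k :: nat
    have "a + of_nat k \<noteq> 0" using d(1) far(2)[of a k] by simp
    hence "(a + of_nat k) powr of_nat (Suc m) = (a + of_nat k) ^ Suc m"
      by (simp add: powr_nat' del: of_nat_Suc)
    thus "(-1) ^ m / fact m * ((-1) ^ m * fact m * (z ^ k / (a + of_nat k) ^ Suc m)) =
        z ^ k / (a + of_nat k) powr of_nat (Suc m)"
      by (simp flip: power_mult_distrib mult.assoc del: of_nat_Suc)
  qed
  finally have "lerch_phi z (of_nat (Suc m)) a = (-1) ^ m / fact m * (deriv ^^ m) (\<lambda>b. \<Sum>k. z ^ k / (b + of_nat k)) a"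
    unfolding lerch_phi_def by (rule sums_unique[symmetric])
  thus "(deriv ^^ m) (\<lambda>b. \<Sum>k. z ^ k / (b + of_nat k)) a = (-1) ^ m * fact m * lerch_phi z (of_nat (Suc m)) a"
    by (simp flip: power_mult_distrib mult.assoc)
qed

text \<open>The condition on \<open>b\<close> cuts out an open half-plane on which both pieces
  converge absolutely for every power, so each may be differentiated under the integral.\<close>

lemma has_field_derivative_punctured_ray_integral:
  fixes b c :: complex
  assumes c: "norm c = 1" "Re c > 0" and e: "0 < \<epsilon>" "0 \<le> R" and b: "Re ((b - 1) * c) < 0"
  defines "g \<equiv> (\<lambda>m b r. (of_real r * c) ^ m * exp (b * (of_real r * c)) * (c / (exp (of_real (r - R) * c) - 1)))"
  shows "((\<lambda>b. integral {0..R - \<epsilon>} (g m b) + integral {R + \<epsilon>..} (g m b)) has_field_derivative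
           integral {0..R - \<epsilon>} (g (Suc m) b) + integral {R + \<epsilon>..} (g (Suc m) b)) (at b)"
proof -
  have "open {b. Re ((b - 1) * c) < 0}"
    by (intro open_Collect_less continuous_intros)
  with b c e show ?thesis
    unfolding g_def
    by (intro DERIV_add has_field_derivative_integral_exp_power[where A = "{b. Re ((b - 1) * c) < 0}"]
          inner_ray_absolutely_integrable outer_ray_absolutely_integrable) auto
qed

text \<open>The case of order 1 before the limit: the Lerch series minus the punctured integral is
  \<open>exp (b * R * c)\<close>, that is \<open>z\<close> to the power \<open>-b\<close>, times the
  damped cotangent series.\<close>

lemma punctured_ray_integral_bound:
  fixes b c :: complex
  assumes c: "Re c > 0" and e: "0 < \<epsilon>" "\<epsilon> \<le> R" and b: "Re ((b - 1) * c) < 0" "b \<notin> \<int>"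
    and sm: "summable (\<lambda>k. exp (- (of_real R * c)) ^ k / (b + of_nat k))"
    and bound: "\<And>s. (\<lambda>k. exp (- (b + of_nat k) * (of_real \<epsilon> * c)) / (b + of_nat k)
         + exp ((b - 1 - of_nat k) * (of_real \<epsilon> * c)) / (b - 1 - of_nat k)) sums s \<Longrightarrow>
      norm (s - of_real pi * cot (of_real pi * b)) \<le> C"
  defines "g \<equiv> (\<lambda>r. exp (b * (of_real r * c)) * (c / (exp (of_real (r - R) * c) - 1)))"
  shows "norm (integral {0..R - \<epsilon>} g + integral {R + \<epsilon>..} g
               + of_real pi * (exp (b * (of_real R * c)) * cot (of_real pi * b))
               - (\<Sum>k. exp (- (of_real R * c)) ^ k / (b + of_nat k)))
         \<le> exp (norm b * (R * norm c)) * C"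
proof -
  define X where "X = exp (b * (of_real R * c))"
  define P where "P = (\<Sum>k. exp (- (of_real R * c)) ^ k / (b + of_nat k))"
  define I where "I = integral {0..R - \<epsilon>} g + integral {R + \<epsilon>..} g"
  have 1: "(\<lambda>k. exp (- (of_nat k * (of_real R * c))) / (b + of_nat k)) sums P"
    using summable_sums[OF sm] by (simp add: P_def flip: exp_of_nat_mult)
  have "(\<lambda>k. (exp (- (of_nat k * (of_real R * c))) / (b + of_nat k)
            - X * (exp (- (b + of_nat k) * (of_real \<epsilon> * c)) / (b + of_nat k)))
          + - X * (exp ((b - 1 - of_nat k) * (of_real \<epsilon> * c)) / (b - 1 - of_nat k))) sums I"
    unfolding I_def X_def g_def
    by (intro sums_add inner_ray_integral_sums outer_ray_integral_sums c b e)
  \<comment> \<open>Subtraction cancels the Lerch summands, and dividing by the nonzero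
    \<open>X\<close> isolates the damped series, to which \<open>bound\<close> applies.\<close>
  from sums_divide[OF sums_diff[OF 1 this], of X]
  have "(\<lambda>k. exp (- (b + of_nat k) * (of_real \<epsilon> * c)) / (b + of_nat k)
         + exp ((b - 1 - of_nat k) * (of_real \<epsilon> * c)) / (b - 1 - of_nat k)) sums ((P - I) / X)"
    by (simp add: X_def add_divide_distrib)
  from bound[OF this] have C: "norm ((P - I) / X - of_real pi * cot (of_real pi * b)) \<le> C" .
  have "I + of_real pi * (X * cot (of_real pi * b)) - P = - (X * ((P - I) / X - of_real pi * cot (of_real pi * b)))"
    by (simp add: X_def field_simps)
  also have "norm \<dots> = norm X * norm ((P - I) / X - of_real pi * cot (of_real pi * b))"
    by (simp only: norm_minus_cancel norm_mult)
  also have "\<dots> \<le> exp (norm b * (R * norm c)) * C"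
  proof (rule mult_mono[OF _ C])
    have "norm X \<le> exp (norm (b * (of_real R * c)))"
      unfolding X_def by (rule norm_exp)
    thus "norm X \<le> exp (norm b * (R * norm c))"
      using e by (simp add: norm_mult)
  qed auto
  finally show ?thesis
    by (simp add: I_def X_def P_def)
qed

text \<open>Uniform convergence for order 1 on a neighbourhood of \<open>a\<close> passes to the
  \<open>m\<close>-th derivatives in \<open>b\<close>. The cotangent term does not depend on
  \<epsilon>, so its derivative can be moved to the limit side.\<close>

lemma punctured_ray_integral_tendsto:
  fixes a c :: complex and R :: real
  assumes c: "norm c = 1" "Re c > 0" and R: "R > 0" and a: "a \<notin> \<int>" "Re ((a - 1) * c) < 0"
  defines "g \<equiv> (\<lambda>m b r. (of_real r * c) ^ m * exp (b * (of_real r * c)) * (c / (exp (of_real (r - R) * c) - 1)))"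
  shows "((\<lambda>\<epsilon>. integral {0..R - \<epsilon>} (g m a) + integral {R + \<epsilon>..} (g m a)) \<longlongrightarrow>
           (-1) ^ m * fact m * lerch_phi (exp (- (of_real R * c))) (of_nat (Suc m)) a
           - of_real pi * (deriv ^^ m) (\<lambda>b. exp (b * (of_real R * c)) * cot (of_real pi * b)) a) (at_right 0)"
proof -
  define z where "z = exp (- (of_real R * c))"
  define H where "H = (\<lambda>\<epsilon> m b. integral {0..R - \<epsilon>} (g m b) + integral {R + \<epsilon>..} (g m b))"
  define E where "E = (\<lambda>b. exp (b * (of_real R * c)) * cot (of_real pi * b))"
  define \<Phi> where "\<Phi> = (\<lambda>b. \<Sum>k. z ^ k / (b + of_nat k))"
  have z: "norm z < 1" using c R by (simp add: z_def)
  obtain d C where d: "d > 0" "\<And>b m. b \<in> ball a d \<Longrightarrow> norm (b + of_int m) \<ge> d"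
    and C: "\<And>b \<epsilon> s. b \<in> ball a d \<Longrightarrow> 0 < \<epsilon> \<Longrightarrow> \<epsilon> \<le> 1 \<Longrightarrow>
      (\<lambda>k. exp (- (b + of_nat k) * (of_real \<epsilon> * c)) / (b + of_nat k)
         + exp ((b - 1 - of_nat k) * (of_real \<epsilon> * c)) / (b - 1 - of_nat k)) sums s \<Longrightarrow>
      norm (s - of_real pi * cot (of_real pi * b)) \<le> C * sqrt \<epsilon>"
    using damped_cot_series_bound[OF a(1) c] by blast
  have notint: "b \<notin> \<int>" if "b \<in> ball a d" for b
  proof
    assume "b \<in> \<int>"
    then obtain j where "b = of_int j" by (auto elim: Ints_cases)
    thus False using d(2)[OF that, of "- j"] d(1) by simp
  qed
  \<comment> \<open>The ball gives the uniform estimates and keeps the cotangent holomorphic; the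
    half-plane makes the outer integrals converge.\<close>
  define A where "A = ball a d \<inter> {b. Re ((b - 1) * c) < 0}"
  have A: "open A" "a \<in> A"
    using a d unfolding A_def by (auto intro!: open_Int open_Collect_less continuous_intros)
  have deriv_H: "(H \<epsilon> m has_field_derivative H \<epsilon> (Suc m) b) (at b)" if "\<epsilon> > 0" "b \<in> A" for \<epsilon> m b
    unfolding H_def g_def using that R
    by (intro has_field_derivative_punctured_ray_integral c) (auto simp: A_def)
  have holo_H: "H \<epsilon> 0 holomorphic_on A" if "\<epsilon> > 0" for \<epsilon>
    using deriv_H[OF that] A by (auto simp: holomorphic_on_open)
  have holo_E: "E holomorphic_on A"
    unfolding E_def cot_def using notint by (intro holomorphic_intros) (force simp: sin_eq_0 A_def)
  define K where "K = exp ((norm a + d) * R) * C"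
  have bound: "norm (H \<epsilon> 0 b + of_real pi * E b - \<Phi> b) \<le> K * sqrt \<epsilon>"
    if b: "b \<in> A" and \<epsilon>: "0 < \<epsilon>" "\<epsilon> \<le> R" "\<epsilon> \<le> 1" for b \<epsilon>
  proof -
    have b': "b \<in> ball a d" "Re ((b - 1) * c) < 0" using b by (auto simp: A_def)
    have "norm (H \<epsilon> 0 b + of_real pi * E b - \<Phi> b) \<le> exp (norm b * (R * norm c)) * (C * sqrt \<epsilon>)"
      using punctured_ray_integral_bound[OF c(2) \<epsilon>(1,2) b'(2) notint[OF b'(1)]
          lerch_series_higher_deriv(2)[OF z d b'(1), unfolded z_def] C[OF b'(1) \<epsilon>(1,3)]]
      by (simp add: H_def E_def \<Phi>_def g_def z_def)
    also have "\<dots> \<le> exp ((norm a + d) * R) * (C * sqrt \<epsilon>)"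
    proof (rule mult_right_mono)
      have "norm b \<le> norm a + d"
        using b' norm_triangle_ineq2[of b a] by (auto simp: dist_norm norm_minus_commute)
      thus "exp (norm b * (R * norm c)) \<le> exp ((norm a + d) * R)"
        using c R by (simp add: mult_right_mono)
      \<comment> \<open>The sign of \<open>C\<close> is not part of what was obtained; it follows
        because the product already bounds a norm.\<close>
      have "0 \<le> exp (norm b * (R * norm c)) * (C * sqrt \<epsilon>)"
        using \<open>_ \<le> exp (norm b * (R * norm c)) * (C * sqrt \<epsilon>)\<close> norm_ge_zero order_trans by blast
      thus "0 \<le> C * sqrt \<epsilon>"
        by (simp add: zero_le_mult_iff)
    qed
    finally show ?thesis by (simp add: K_def)
  qed
  have small: "eventually (\<lambda>\<epsilon>. 0 < \<epsilon> \<and> \<epsilon> < min R 1) (at_right (0::real))"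
    using eventually_at_right_real[of 0 "min R 1"] R by simp
  have "uniform_limit A (\<lambda>\<epsilon> b. H \<epsilon> 0 b + of_real pi * E b) \<Phi> (at_right 0)"
  proof (rule uniform_limitI)
    fix \<eta> :: real assume "\<eta> > 0"
    have "((\<lambda>\<epsilon>. K * sqrt \<epsilon>) \<longlongrightarrow> K * sqrt 0) (at_right 0)"
      by (intro tendsto_intros)
    hence "eventually (\<lambda>\<epsilon>. K * sqrt \<epsilon> < \<eta>) (at_right 0)"
      using \<open>\<eta> > 0\<close> by (intro order_tendstoD) auto
    with small show "eventually (\<lambda>\<epsilon>. \<forall>b\<in>A. dist (H \<epsilon> 0 b + of_real pi * E b) (\<Phi> b) < \<eta>) (at_right 0)"
      by eventually_elim (auto simp: dist_norm intro: le_less_trans[OF bound])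
  qed
  hence "((\<lambda>\<epsilon>. (deriv ^^ m) (\<lambda>b. H \<epsilon> 0 b + of_real pi * E b) a) \<longlongrightarrow> (deriv ^^ m) \<Phi> a) (at_right 0)"
    using A holo_E holo_H small
    by (intro higher_deriv_complex_uniform_limit[where A = A])
       (auto elim!: eventually_mono intro!: holomorphic_intros)
  also have "(deriv ^^ m) \<Phi> a = (-1) ^ m * fact m * lerch_phi z (of_nat (Suc m)) a"
    unfolding \<Phi>_def by (rule lerch_series_higher_deriv(1)[OF z d])
  finally have "((\<lambda>\<epsilon>. (deriv ^^ m) (\<lambda>b. H \<epsilon> 0 b + of_real pi * E b) a - of_real pi * (deriv ^^ m) E a) \<longlongrightarrow>
      (-1) ^ m * fact m * lerch_phi z (of_nat (Suc m)) a - of_real pi * (deriv ^^ m) E a) (at_right 0)"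
    by (intro tendsto_intros)
  moreover have "eventually (\<lambda>\<epsilon>. (deriv ^^ m) (\<lambda>b. H \<epsilon> 0 b + of_real pi * E b) a - of_real pi * (deriv ^^ m) E a
      = H \<epsilon> m a) (at_right 0)"
    using small
  proof eventually_elim
    case (elim \<epsilon>)
    have "(deriv ^^ m) (\<lambda>b. H \<epsilon> 0 b + of_real pi * E b) a = (deriv ^^ m) (H \<epsilon> 0) a + (deriv ^^ m) (\<lambda>b. of_real pi * E b) a"
      using elim A holo_E holo_H by (intro higher_deriv_add[where S = A] holomorphic_intros) auto
    also have "(deriv ^^ m) (H \<epsilon> 0) a = H \<epsilon> m a"
      using elim A deriv_H by (intro higher_deriv_eqI[where A = A]) auto
    also have "(deriv ^^ m) (\<lambda>b. of_real pi * E b) a = of_real pi * (deriv ^^ m) E a"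
      using A holo_E by (intro higher_deriv_cmult[where A = A]) auto
    finally show ?case by simp
  qed
  ultimately have "((\<lambda>\<epsilon>. H \<epsilon> m a) \<longlongrightarrow>
      (-1) ^ m * fact m * lerch_phi z (of_nat (Suc m)) a - of_real pi * (deriv ^^ m) E a) (at_right 0)"
    by (rule Lim_transform_eventually)
  thus ?thesis
    by (simp add: H_def E_def z_def)
qed

section \<open>Evaluation of the principal value\<close>

lemma pv_ray_integral_unique:
  assumes "has_pv_ray_integral f \<phi> p I"
  shows "pv_ray_integral f \<phi> p = I"
  unfolding pv_ray_integral_def
proof (rule the_equality[where P = "has_pv_ray_integral f \<phi> p"])
  fix J assume "has_pv_ray_integral f \<phi> p J"
  with assms show "J = I"
    unfolding has_pv_ray_integral_def Let_def
    by (intro tendsto_unique[OF trivial_limit_at_right_real]) auto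
qed fact

theorem theorem1:
  fixes z a :: complex and n :: nat and \<phi> :: real
  assumes "0 < norm z" and "norm z < 1"
    and "- pi < Arg z" and "Arg z < pi"
    and "\<phi> = Arg (- Ln z)"
    and "n \<ge> 1"
    and "a \<notin> \<int>\<^sub>\<le>\<^sub>0"
    and "Re ((a - 1) * cis \<phi>) < 0"
  shows "(\<exists>I. has_pv_ray_integral (\<lambda>t. t ^ (n - 1) * exp (a * t) / (z * exp t - 1)) \<phi> (- Ln z) I) \<and>
    lerch_phi z (of_nat n) a =
      (-1) ^ (n - 1) / fact (n - 1) *
      (pv_ray_integral (\<lambda>t. t ^ (n - 1) * exp (a * t) / (z * exp t - 1)) \<phi> (- Ln z) +
       of_real pi *
         (deriv ^^ (n - 1)) (\<lambda>b. exp (- b * Ln z) * cot (of_real pi * b)) a)"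
proof -
  define c where "c = cis \<phi>"
  define R where "R = norm (- Ln z)"
  define m where "m = n - 1"
  have n: "n = Suc m" using assms by (simp add: m_def)
  have L: "- Ln z = of_real R * c"
    using rcis_cmod_Arg[of "- Ln z"] assms by (simp add: R_def c_def rcis_def)
  have z: "z = exp (- (of_real R * c))"
    using assms(1) by (simp flip: L)
  \<comment> \<open>The real part of \<open>- Ln z\<close> is \<open>- ln (norm z)\<close>, positive
    because \<open>norm z < 1\<close>. Since \<open>R\<close> is a norm, both factors are
    positive.\<close>
  have ReL: "R * Re c > 0"
  proof -
    have "R * Re c = Re (- Ln z)" by (simp only: L) simp
    also have "\<dots> > 0" using assms by (simp add: Re_Ln)
    finally show ?thesis .
  qed
  have R: "R > 0" and c: "Re c > 0" "norm c = 1"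
    using ReL by (auto simp: zero_less_mult_iff R_def c_def)
  have ac: "Re ((a - 1) * c) < 0" using assms by (simp add: c_def)
  \<comment> \<open>A positive integer \<open>a\<close> would make \<open>Re ((a - 1) * c)\<close>
    nonnegative, so the cotangent is regular at \<open>a\<close>.\<close>
  have a: "a \<notin> \<int>"
  proof
    assume "a \<in> \<int>"
    then obtain j where j: "a = of_int j" by (auto elim: Ints_cases)
    have "j > 0" using assms(7) j nonpos_Ints_of_int[of j] by (auto simp: not_less[symmetric])
    hence "0 \<le> (of_int j - 1) * Re c" using c by (intro mult_nonneg_nonneg) auto
    thus False using ac by (simp add: j)
  qed
  define g where "g = (\<lambda>m b r. (of_real r * c) ^ m * exp (b * (of_real r * c)) * (c / (exp (of_real (r - R) * c) - 1)))"
  define f where "f = (\<lambda>t. t ^ (n - 1) * exp (a * t) / (z * exp t - 1))"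
  \<comment> \<open>Absorbing \<open>z\<close> into the exponential puts the pole at
    \<open>r = R\<close>; the extra factor \<open>c\<close> is the derivative of
    \<open>t = r * c\<close>.\<close>
  have fg: "(\<lambda>r. f (of_real r * cis \<phi>) * cis \<phi>) = g m a"
  proof
    fix r
    have "z * exp (of_real r * c) = exp (of_real (r - R) * c)"
      by (simp add: z mult_exp_exp algebra_simps)
    thus "f (of_real r * cis \<phi>) * cis \<phi> = g m a r"
      by (simp add: f_def g_def m_def flip: c_def)
  qed
  define I where "I = (-1) ^ m * fact m * lerch_phi z (of_nat n) a
     - of_real pi * (deriv ^^ m) (\<lambda>b. exp (- b * Ln z) * cot (of_real pi * b)) a"
  have E: "exp (- b * Ln z) = exp (b * (of_real R * c))" for b
    by (simp flip: L)
  have pv: "has_pv_ray_integral f \<phi> (- Ln z) I"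
    unfolding has_pv_ray_integral_def Let_def fg R_def[symmetric]
  proof (intro conjI allI impI)
    show "g m a integrable_on {0..R - \<epsilon>}" if "0 < \<epsilon> \<and> \<epsilon> < R" for \<epsilon>
      unfolding g_def using that c
      by (intro set_lebesgue_integral_eq_integral(1) inner_ray_absolutely_integrable) auto
    show "g m a integrable_on {R + \<epsilon>..}" if "0 < \<epsilon> \<and> \<epsilon> < R" for \<epsilon>
      unfolding g_def using that c ac
      by (intro set_lebesgue_integral_eq_integral(1) outer_ray_absolutely_integrable) auto
    show "((\<lambda>\<epsilon>. integral {0..R - \<epsilon>} (g m a) + integral {R + \<epsilon>..} (g m a)) \<longlongrightarrow> I) (at_right 0)"
      unfolding I_def E g_def n z[symmetric]
      using punctured_ray_integral_tendsto[OF c(2,1) R a ac, of m, folded z] .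
  qed
  \<comment> \<open>Solves the definition of \<open>I\<close> for the Lerch value; the sign
    \<open>(-1) ^ m\<close> is its own inverse.\<close>
  have "lerch_phi z (of_nat n) a =
      (-1) ^ m / fact m * (I + of_real pi * (deriv ^^ m) (\<lambda>b. exp (- b * Ln z) * cot (of_real pi * b)) a)"
    unfolding I_def by (simp flip: power_mult_distrib mult.assoc)
  thus ?thesis
    using pv pv_ray_integral_unique[OF pv] unfolding f_def m_def by auto
qed

end
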